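(* For every $\kappa\in(0,\infty)$ and every $n\ge 1$, the expected ERM loss $w\mapsto\mathbb{E}_\kappa[\mathcal{L}_S(w)]$, $w\in\mathbb{R}^d$, has a unique minimizer $w^*(\kappa)$ over $\mathbb{R}^d$. In addition, $w^*(\kappa)$ has the same direction as the Bayes optimal solution $\Sigma^{-1}\mu$, i.e. $w^*(\kappa)=c\,\Sigma^{-1}\mu$ for some $c>0$.
   Context: Fix $d\ge 1$, a nonzero vector $\mu\in\mathbb{R}^d$ and a (symmetric) positive definite matrix $\Sigma\in\mathbb{R}^{d\times d}$ with $\|\mu\|^2=\|\Sigma\|$ ($\ell_2$ norm for vectors, spectral norm for matrices). For $\kappa\in(0,\infty)$, $\mathcal{D}_\kappa$ is the distribution of $(x,y)\in\mathbb{R}^d\times\{0,1\}$ with $y$ uniform on $\{0,1\}$, $x\mid y=1\sim N(\mu,\kappa^{-1}\Sigma)$ and $x\mid y=0\sim N(-\mu,\kappa^{-1}\Sigma)$. The training set is $S=\{(x_i,y_i)\}_{i=1}^n$, drawn i.i.d. from $\mathcal{D}_\kappa$, and $\mathbb{E}_\kappa$ is expectation over $S$. Let $l(z)=\log(1+e^{-z})$. The ERM loss is $$\mathcal{L}_S(w)=\frac1n\sum_{i=1}^n\big[y_i\,l(w^\top x_i)+(1-y_i)\,l(-w^\top x_i)\big],\quad w\in\mathbb{R}^d.$$ *)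

theory Defs
  imports "HOL-Probability.Probability"
begin

definition sym_pos_def :: "real ^ 'd ^ 'd \<Rightarrow> bool" where
  "sym_pos_def A \<longleftrightarrow> transpose A = A \<and> (\<forall>x. x \<noteq> 0 \<longrightarrow> x \<bullet> (A *v x) > 0)"

definition spectral_norm :: "real ^ 'd ^ 'd \<Rightarrow> real" where
  "spectral_norm A = onorm (\<lambda>x. A *v x)"

(* The Gaussian law is given by its Lebesgue density; this is meaningful only for a
   (symmetric) positive definite covariance matrix C. *)
definition mvn_density :: "real ^ 'd \<Rightarrow> real ^ 'd ^ 'd \<Rightarrow> real ^ 'd \<Rightarrow> real" where
  "mvn_density m C x =
     exp (- ((x - m) \<bullet> (matrix_inv C *v (x - m))) / 2) / sqrt ((2 * pi) ^ CARD('d) * det C)"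

definition mvn :: "real ^ 'd \<Rightarrow> real ^ 'd ^ 'd \<Rightarrow> (real ^ 'd) measure" where
  "mvn m C = density lborel (\<lambda>x. ennreal (mvn_density m C x))"

(* Joint law of (x, y): draw the label y uniformly from {0, 1}, then x from the
   conditional law of x given y. *)
definition data_dist ::
  "real ^ 'd \<Rightarrow> real ^ 'd ^ 'd \<Rightarrow> real \<Rightarrow> ((real ^ 'd) \<times> nat) measure" where
  "data_dist \<mu> \<Sigma> \<kappa> =
     measure_pmf (pmf_of_set {0, 1}) \<bind>
       (\<lambda>y. distr (mvn (if y = 1 then \<mu> else - \<mu>) ((1 / \<kappa>) *\<^sub>R \<Sigma>))
                  (borel \<Otimes>\<^sub>M count_space UNIV) (\<lambda>x. (x, y)))"

definition training_dist ::
  "real ^ 'd \<Rightarrow> real ^ 'd ^ 'd \<Rightarrow> real \<Rightarrow> nat \<Rightarrow> (nat \<Rightarrow> (real ^ 'd) \<times> nat) measure" where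
  "training_dist \<mu> \<Sigma> \<kappa> n = Pi\<^sub>M {1..n} (\<lambda>_. data_dist \<mu> \<Sigma> \<kappa>)"

definition logistic_loss :: "real \<Rightarrow> real" where
  "logistic_loss z = ln (1 + exp (- z))"

definition erm_loss :: "nat \<Rightarrow> (nat \<Rightarrow> (real ^ 'd) \<times> nat) \<Rightarrow> real ^ 'd \<Rightarrow> real" where
  "erm_loss n S w =
     (1 / real n) *
     (\<Sum>i=1..n. real (snd (S i)) * logistic_loss (w \<bullet> fst (S i))
              + (1 - real (snd (S i))) * logistic_loss (- (w \<bullet> fst (S i))))"

definition expected_erm_loss ::
  "real ^ 'd \<Rightarrow> real ^ 'd ^ 'd \<Rightarrow> real \<Rightarrow> nat \<Rightarrow> real ^ 'd \<Rightarrow> real" where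
  "expected_erm_loss \<mu> \<Sigma> \<kappa> n w = (\<integral>S. erm_loss n S w \<partial>training_dist \<mu> \<Sigma> \<kappa> n)"

end

theory Submission imports Defs begin

text \<open>Reflecting the class \<open>y = 0\<close> through the origin, the expected loss equals
  \<open>G w = E[l (w \<bullet> x)]\<close> for a single Gaussian \<open>x\<close> with mean \<open>\<mu>\<close> and covariance \<open>C = \<Sigma> / \<kappa>\<close>. It is strictly
  convex since \<open>l\<close> is and the Gaussian charges every open set, and it is coercive since
  \<open>l z \<ge> max 0 (- z)\<close>; hence there is exactly one minimizer. As \<open>w \<bullet> x\<close> is again Gaussian,
  \<open>G w\<close> depends only on \<open>w \<bullet> \<mu>\<close> and \<open>w \<bullet> C w\<close>. Both are preserved by the \<open>C\<close>-orthogonal reflection in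
  the line spanned by \<open>C\<^sup>-\<^sup>1 \<mu>\<close>, so the minimizer is fixed by the reflection and lies on this line.
  Finally \<open>ln 2 - z / 2 \<le> l z \<le> ln 2 - z / 2 + z\<^sup>2 / 2\<close> shows that \<open>G\<close> drops below \<open>ln 2\<close> somewhere,
  but only where \<open>w \<bullet> \<mu> > 0\<close>.\<close>

section \<open>Linear images of Lebesgue measure\<close>

lemma borel_measurable_matrix_vector [measurable]:
  "(\<lambda>x::real^'n. A *v x) \<in> borel \<rightarrow>\<^sub>M (borel :: (real^'m) measure)"
  by (intro borel_measurable_continuous_onI linear_continuous_on matrix_vector_mul_bounded_linear)

text \<open>A Borel measure is \<open>lborel\<close> once it gives every open box its volume, and
  the preimage of a box under \<open>f\<close> is its image under \<open>g\<close>. So it is enough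
  to control the volume of \<open>g\<close>-images, which is the form in which volume facts about
  linear maps come.\<close>

lemma distr_lborel_eq_lborel:
  fixes f g :: "real^'n \<Rightarrow> real^'n"
  assumes "linear g" and inv: "\<And>x. f (g x) = x" "\<And>x. g (f x) = x"
    and meas: "\<And>a b. cbox a b \<noteq> {} \<Longrightarrow> measure lebesgue (g ` cbox a b) = measure lebesgue (cbox a b)"
  shows "distr lborel borel f = lborel"
proof (rule lborel_eqI[symmetric])
  fix l u :: "real^'n" assume le: "\<And>b. b \<in> Basis \<Longrightarrow> l \<bullet> b \<le> u \<bullet> b"
  have "bij g" using inv by (metis bijI')
  have "linear f"
    using \<open>linear g\<close> inv by (metis \<open>bij g\<close> bij_is_inj inj_linear_imp_inv_linear inv_equality)
  then have f[measurable]: "f \<in> borel \<rightarrow>\<^sub>M borel"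
    by (intro borel_measurable_continuous_onI linear_continuous_on)
       (simp add: linear_conv_bounded_linear)
  have vimage: "f -` S = g ` S" for S
    using inv by (auto simp: image_iff) metis
  have gcbox: "g ` cbox l u \<in> lmeasurable"
    by (simp add: measurable_linear_image_interval \<open>linear g\<close>)
  \<comment> \<open>The hypothesis speaks of closed boxes, the uniqueness criterion of open ones.
    The two images differ by the linear image of a box boundary, a null set.\<close>
  have negl: "negligible (g ` cbox l u - g ` box l u)"
  proof -
    have "g ` cbox l u - g ` box l u = g ` (cbox l u - box l u)"
      using \<open>bij g\<close> by (simp add: bij_is_inj image_set_diff)
    moreover have "negligible (g ` (cbox l u - box l u))"
      using \<open>linear g\<close>
      by (intro negligible_differentiable_image_negligible negligible_frontier_interval)
         (auto simp: linear_imp_differentiable_on)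
    ultimately show ?thesis by simp
  qed
  have sets: "g ` box l u \<in> sets borel"
    using measurable_sets[OF f, of "box l u"] by (simp add: vimage)
  have sub: "g ` box l u \<subseteq> g ` cbox l u" by (intro image_mono box_subset_cbox)
  have gbox: "g ` box l u \<in> lmeasurable" "measure lebesgue (g ` box l u) = measure lebesgue (g ` cbox l u)"
  proof -
    have symd: "negligible (g ` cbox l u - g ` box l u \<union> (g ` box l u - g ` cbox l u))"
      using negl sub by (metis Diff_eq_empty_iff sup_bot_right)
    show "g ` box l u \<in> lmeasurable"
      using lmeasurable_negligible_symdiff[OF gcbox symd] .
    show "measure lebesgue (g ` box l u) = measure lebesgue (g ` cbox l u)"
      using measure_negligible_symdiff[OF gcbox symd] by simp
  qed
  have "emeasure (distr lborel borel f) (box l u) = emeasure lborel (g ` box l u)"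
    by (simp add: emeasure_distr vimage)
  also have "\<dots> = emeasure lebesgue (g ` box l u)"
    using sets by simp
  also have "\<dots> = ennreal (measure lebesgue (g ` cbox l u))"
    using gbox by (simp add: emeasure_eq_measure2)
  also have "measure lebesgue (g ` cbox l u) = measure lebesgue (cbox l u)"
    using le by (intro meas) (simp add: box_ne_empty)
  also have "\<dots> = (\<Prod>b\<in>Basis. (u - l) \<bullet> b)"
    using le by (simp add: measure_lborel_cbox_eq inner_diff_left)
  finally show "emeasure (distr lborel borel f) (box l u) = ennreal (\<Prod>b\<in>Basis. (u - l) \<bullet> b)" .
qed simp

text \<open>An involution makes the coordinate map its own inverse, and it carries a box to a box
  with the same side lengths in another order. The transpositions among the elementary matrices are
  of this kind.\<close>

lemma distr_lborel_permute_coordinates: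
  fixes p :: "'n::finite \<Rightarrow> 'n"
  assumes "p \<circ> p = id"
  shows "distr lborel borel (\<lambda>x::real^'n. \<chi> i. x $ p i) = lborel"
proof (rule distr_lborel_eq_lborel[where g="\<lambda>x. \<chi> i. x $ p i"])
  have pp: "p (p i) = i" for i using assms by (metis comp_apply id_apply)
  show "linear (\<lambda>x::real^'n. \<chi> i. x $ p i)"
    by (rule linearI) (simp_all add: vec_eq_iff)
  fix x :: "real^'n"
  show "(\<chi> i. (\<chi> i. x $ p i) $ p i) = x" "(\<chi> i. (\<chi> i. x $ p i) $ p i) = x"
    by (simp_all add: vec_eq_iff pp)
next
  fix a b :: "real^'n" assume ne: "cbox a b \<noteq> {}"
  have pp: "p (p i) = i" for i using assms by (metis comp_apply id_apply)
  have bij: "bij p" by (metis bijI' pp)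
  have "(\<lambda>x. \<chi> i. x $ p i) ` cbox a b = cbox (\<chi> i. a $ p i) (\<chi> i. b $ p i)" (is "?L = ?R")
  proof (rule set_eqI, rule iffI)
    fix y assume y: "y \<in> ?R"
    have "(\<chi> i. y $ p i) \<in> cbox a b"
      using y by (auto simp: mem_box_cart) (metis pp)+
    moreover have "y = (\<chi> i. (\<chi> i. y $ p i) $ p i)" by (simp add: vec_eq_iff pp)
    ultimately show "y \<in> ?L" by (rule rev_image_eqI)
  qed (auto simp: mem_box_cart)
  moreover have "?R \<noteq> {}" using ne by (simp add: interval_ne_empty_cart)
  ultimately show "measure lebesgue ((\<lambda>x. \<chi> i. x $ p i) ` cbox a b) = measure lebesgue (cbox a b)"
    using ne prod.reindex_bij_betw[of p UNIV UNIV "\<lambda>i. b $ i - a $ i"] bij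
    by (simp add: content_cbox_cart bij_betw_def)
qed

text \<open>The minus sign makes the inverse map the shear that adds coordinate \<open>n\<close> to
  coordinate \<open>m\<close>, for which \<open>measure_shear_interval\<close> gives volumes of
  images.\<close>

lemma distr_lborel_shear:
  fixes m n :: "'n::finite"
  assumes "m \<noteq> n"
  shows "distr lborel borel (\<lambda>x::real^'n. \<chi> i. if i = m then x $ m - x $ n else x $ i) = lborel"
proof (rule distr_lborel_eq_lborel)
  let ?g = "\<lambda>x::real^'n. \<chi> i. if i = m then x $ m + x $ n else x $ i"
  show lin: "linear ?g"
    by (rule linearI) (auto simp: vec_eq_iff algebra_simps)
  show "(\<chi> i. if i = m then ?g x $ m - ?g x $ n else ?g x $ i) = x"
       "?g (\<chi> i. if i = m then x $ m - x $ n else x $ i) = x" for x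
    using assms by (simp_all add: vec_eq_iff)
  fix a b :: "real^'n" assume ne: "cbox a b \<noteq> {}"
  \<comment> \<open>\<open>measure_shear_interval\<close> requires the box to lie in the half space \<open>0 \<le> x $ n\<close>.\<close>
  let ?v = "- axis n (a $ n) :: real^'n"
  have ne': "cbox (?v + a) (?v + b) \<noteq> {}"
    using ne by (simp add: interval_ne_empty_cart)
  have "?g ` cbox (?v + a) (?v + b) = (+) (?g ?v) ` ?g ` cbox a b"
    unfolding cbox_translation image_image using linear_add[OF lin] by (intro image_cong) auto
  then have "measure lebesgue (?g ` cbox a b) = measure lebesgue (?g ` cbox (?v + a) (?v + b))"
    by (simp only: measure_translation)
  also have "\<dots> = measure lebesgue (cbox (?v + a) (?v + b))"
    by (rule measure_shear_interval[OF assms ne']) (simp add: axis_def)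
  also have "\<dots> = measure lebesgue (cbox a b)"
    unfolding cbox_translation by (rule measure_translation)
  finally show "measure lebesgue (?g ` cbox a b) = measure lebesgue (cbox a b)" .
qed

text \<open>The change of variables theorems of HOL-Analysis need a well-ordered index type, because they
  compute the determinant of a shear as that of a triangular matrix.\<close>

lemma lborel_eq_density_distr_matrix:
  fixes A :: "real^'n^'n"
  assumes "det A \<noteq> 0"
  shows "lborel = density (distr lborel borel (\<lambda>x. A *v x)) (\<lambda>_. ennreal \<bar>det A\<bar>)"
proof -
  \<comment> \<open>Nonsingularity is a premise inside \<open>P\<close>, so that \<open>P\<close>
    also makes sense for the singular matrices met in the induction over elementary matrices. It
    passes to both factors of a product because the determinant is multiplicative.\<close>
  define P where "P A \<longleftrightarrow> (det A \<noteq> 0 \<longrightarrow>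
    lborel = density (distr lborel borel (\<lambda>x. A *v x)) (\<lambda>_. ennreal \<bar>det A\<bar>))" for A :: "real^'n^'n"
  have mult: "P (A ** B)" if "P A" "P B" for A B
    unfolding P_def
  proof
    assume "det (A ** B) \<noteq> 0"
    then have A: "lborel = density (distr lborel borel (\<lambda>x. A *v x)) (\<lambda>_. ennreal \<bar>det A\<bar>)"
      and B: "lborel = density (distr lborel borel (\<lambda>x. B *v x)) (\<lambda>_. ennreal \<bar>det B\<bar>)"
      using that by (auto simp: P_def det_mul)
    have "lborel = density (distr (density (distr lborel borel (\<lambda>x. B *v x)) (\<lambda>_. ennreal \<bar>det B\<bar>)) borel (\<lambda>x. A *v x)) (\<lambda>_. ennreal \<bar>det A\<bar>)"
      using A B by simp
    also have "\<dots> = density (density (distr (distr lborel borel (\<lambda>x. B *v x)) borel (\<lambda>x. A *v x)) (\<lambda>_. ennreal \<bar>det B\<bar>)) (\<lambda>_. ennreal \<bar>det A\<bar>)"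
      by (subst density_distr[where M="distr lborel borel (\<lambda>x. B *v x)"]) (auto simp: measurable_distr_eq1)
    also have "\<dots> = density (distr lborel borel (\<lambda>x. (A ** B) *v x)) (\<lambda>_. ennreal \<bar>det (A ** B)\<bar>)"
      by (subst distr_distr, simp, simp, subst density_density_eq)
         (auto simp: o_def matrix_vector_mul_assoc det_mul abs_mult ennreal_mult' mult.commute)
    finally show "lborel = \<dots>" .
  qed
  have unimodular: "P A" if "\<bar>det A\<bar> = 1" "distr lborel borel (\<lambda>x. A *v x) = lborel" for A
    using that by (simp add: P_def density_1)
  have diagonal: "P A" if A: "\<And>i j. i \<noteq> j \<Longrightarrow> A $ i $ j = 0" for A
    unfolding P_def
  proof
    assume "det A \<noteq> 0"
    have det: "det A = (\<Prod>i\<in>UNIV. A $ i $ i)" using A by (rule det_diagonal)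
    \<comment> \<open>\<open>lborel_affine_euclidean\<close> takes its scale factors indexed by
      basis vectors; on \<open>axis i 1\<close> this function returns the \<open>i\<close>-th
      diagonal entry.\<close>
    define c where "c b = (\<Sum>i\<in>UNIV. A $ i $ i * b $ i)" for b :: "real^'n"
    have c: "c (axis i 1) = A $ i $ i" for i
      by (simp add: c_def axis_def if_distrib cong: if_cong)
    have inj: "inj (\<lambda>i::'n. axis i (1::real))" by (auto simp: inj_on_def axis_eq_axis)
    have Basis: "(Basis :: (real^'n) set) = (\<lambda>i. axis i 1) ` UNIV"
      by (auto simp: Basis_vec_def)
    have "(\<Sum>j\<in>Basis. (c j * (x \<bullet> j)) *\<^sub>R j) = A *v x" for x
    proof -
      have "(\<Sum>j\<in>UNIV. A $ i $ j * x $ j) = (\<Sum>j\<in>UNIV. if j = i then A $ i $ i * x $ i else 0)" for i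
        by (rule sum.cong) (auto simp: A)
      then have "(A *v x) $ i = A $ i $ i * x $ i" for i
        by (simp add: matrix_vector_mult_def)
      moreover have "(\<Sum>j\<in>Basis. (c j * (x \<bullet> j)) *\<^sub>R j) = (\<Sum>i\<in>UNIV. (A $ i $ i * x $ i) *\<^sub>R axis i 1)"
        unfolding Basis using inj by (subst sum.reindex) (simp_all add: c inner_axis)
      ultimately show ?thesis
        by (simp add: vec_eq_iff axis_def if_distrib cong: if_cong)
    qed
    moreover have "(\<Prod>j\<in>Basis. \<bar>c j\<bar>) = \<bar>det A\<bar>"
      unfolding Basis using inj by (subst prod.reindex) (auto simp: c det abs_prod)
    moreover have "c j \<noteq> 0" if "j \<in> Basis" for j
      using that \<open>det A \<noteq> 0\<close> by (auto simp: Basis c det)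
    ultimately show "lborel = density (distr lborel borel (\<lambda>x. A *v x)) (\<lambda>_. ennreal \<bar>det A\<bar>)"
      using lborel_affine_euclidean[of c 0] by simp
  qed
  have "P A"
  proof (rule induct_matrix_elementary_alt)
    show "P A" if "row i A = 0" for A i
      using that by (simp add: P_def det_zero_row)
  next
    fix m n :: 'n assume "m \<noteq> n"
    have id: "(\<chi> i j. mat 1 $ i $ Transposition.transpose m n j) *v x =
              (\<chi> i. x $ Transposition.transpose m n i)" for x :: "real^'n"
    proof -
      have "(\<Sum>j\<in>UNIV. (if i = Transposition.transpose m n j then 1 else 0) * x $ j) =
            (\<Sum>j\<in>UNIV. if j = Transposition.transpose m n i then x $ j else 0)" for i
        by (rule sum.cong) auto
      then show ?thesis by (simp add: vec_eq_iff matrix_vector_mult_def mat_def)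
    qed
    show "P (\<chi> i j. mat 1 $ i $ Transposition.transpose m n j)"
    proof (rule unimodular)
      show "\<bar>det (\<chi> i j. mat 1 $ i $ Transposition.transpose m n j :: real^'n^'n)\<bar> = 1"
        by (simp add: det_permute_columns permutes_swap_id sign_swap_id abs_mult)
      show "distr lborel borel (\<lambda>x. (\<chi> i j. mat 1 $ i $ Transposition.transpose m n j) *v x) = (lborel :: (real^'n) measure)"
        unfolding id by (rule distr_lborel_permute_coordinates) auto
    qed
  next
    fix m n :: 'n assume mn: "m \<noteq> n"
    \<comment> \<open>The induction asks for the shear with coefficient \<open>1\<close>, while the
      volume lemma above yields the one with \<open>-1\<close>. Conjugating \<open>S (-1)\<close> by
      the diagonal matrix \<open>D\<close> that flips coordinate \<open>n\<close> turns one into the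
      other.\<close>
    define S where "S c = (\<chi> i. if i = m then row m (mat 1) + c *s row n (mat 1) else row i (mat 1) :: real^'n^'n)" for c :: real
    have S_comp: "S c $ i $ j = (if i = m then of_bool (j = m) + c * of_bool (j = n) else of_bool (i = j))" for c i j
      by (auto simp: S_def row_def mat_def)
    have det: "det (S c) = 1" for c
      unfolding S_def using mn by (subst det_row_operation) auto
    have "S (-1) *v x = (\<chi> i. if i = m then x $ m - x $ n else x $ i)" for x
      using mn by (auto simp: vec_eq_iff matrix_vector_mult_def S_comp of_bool_def algebra_simps
                       sum_subtractf sum.distrib if_distrib[of "\<lambda>y. _ * y"] cong: if_cong)
    then have "P (S (-1))"
      using distr_lborel_shear[OF mn] by (intro unimodular) (simp_all add: det)
    moreover define d :: "'n \<Rightarrow> real" where "d i = (if i = n then -1 else 1)" for i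
    moreover define D where "D = (\<chi> i j. if i = j then d i else 0 :: real^'n^'n)"
    moreover have "P D" by (rule diagonal) (simp add: D_def)
    moreover have "(\<chi> i j. of_bool (i = m \<and> j = n \<or> i = j)) = D ** S (-1) ** D"
    proof -
      have "(D ** X) $ i $ j = d i * X $ i $ j" "(X ** D) $ i $ j = X $ i $ j * d j" for X i j
      proof -
        have "(D ** X) $ i $ j = (\<Sum>k\<in>UNIV. if k = i then d i * X $ i $ j else 0)"
          unfolding matrix_matrix_mult_def D_def
          by (simp only: vec_lambda_beta) (intro sum.cong; auto)
        moreover have "(X ** D) $ i $ j = (\<Sum>k\<in>UNIV. if k = j then X $ i $ j * d j else 0)"
          unfolding matrix_matrix_mult_def D_def
          by (simp only: vec_lambda_beta) (intro sum.cong; auto)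
        ultimately show "(D ** X) $ i $ j = d i * X $ i $ j" "(X ** D) $ i $ j = X $ i $ j * d j"
          by simp_all
      qed
      then show ?thesis
        using mn by (simp add: vec_eq_iff S_comp d_def)
    qed
    ultimately show "P (\<chi> i j. of_bool (i = m \<and> j = n \<or> i = j))"
      by (simp add: mult)
  qed (fact mult diagonal)+
  then show ?thesis using assms by (simp add: P_def)
qed

section \<open>Factorization of positive definite matrices\<close>

text \<open>The columns of \<open>B\<close> are a basis orthonormal for the inner product given by
  \<open>M\<close>. Such a basis is an orthonormal set of largest size: if it did not span, one
  Gram-Schmidt step would enlarge it.\<close>

lemma pos_def_congruent_identity:
  fixes M :: "real^'n^'n"
  assumes "sym_pos_def M"
  obtains B :: "real^'n^'n" where "transpose B ** M ** B = mat 1"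
proof -
  let ?f = "\<lambda>x y. x \<bullet> (M *v y)"
  have sym: "?f x y = ?f y x" for x y
    using assms by (metis dot_lmul_matrix inner_commute sym_pos_def_def transpose_matrix_vector)
  have pos: "?f x x > 0" if "x \<noteq> 0" for x
    using assms that by (simp add: sym_pos_def_def)
  define ON where "ON S \<longleftrightarrow> (\<forall>x\<in>S. ?f x x = 1) \<and> (\<forall>x\<in>S. \<forall>y\<in>S. x \<noteq> y \<longrightarrow> ?f x y = 0)"
    for S :: "(real^'n) set"
  \<comment> \<open>Pairing with a member of an orthonormal set reads off its coefficient. This
    gives independence, hence the size bound, and later the orthogonality of the Gram-Schmidt
    remainder.\<close>
  have coeff: "?f y (\<Sum>x\<in>T. u x *\<^sub>R x) = u y" if "ON S" "finite T" "T \<subseteq> S" "y \<in> T" for S T u y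
  proof -
    have "?f y (\<Sum>x\<in>T. u x *\<^sub>R x) = (\<Sum>x\<in>T. u x * ?f y x)"
      by (simp add: vec.sum linear_sum[OF matrix_vector_mul_linear] matrix_vector_mult_scaleR inner_sum_right)
    also have "\<dots> = (\<Sum>x\<in>T. if x = y then u y else 0)"
      using that by (intro sum.cong) (auto simp: ON_def subset_iff)
    also have "\<dots> = u y" using that by simp
    finally show ?thesis .
  qed
  have indep: "independent S" if "ON S" for S
    unfolding independent_explicit_module
  proof (intro allI impI)
    fix T u v assume *: "finite T" "T \<subseteq> S" "(\<Sum>v\<in>T. u v *\<^sub>R v) = 0" "v \<in> T"
    show "u v = 0" using coeff[OF that *(1,2,4), of u] *(3) by simp
  qed
  have bound: "finite S \<and> card S \<le> CARD('n)" if "ON S" for S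
    using independent_bound[OF indep[OF that]] by simp
  define k where "k = (GREATEST k. \<exists>S. ON S \<and> card S = k)"
  have "\<exists>S. ON S \<and> card S = k"
    unfolding k_def
  proof (rule GreatestI_nat)
    show "\<exists>S. ON S \<and> card S = 0" by (rule exI[of _ "{}"]) (simp add: ON_def)
  qed (use bound in auto)
  then obtain S where S: "ON S" "card S = k" by auto
  have max: "card T \<le> card S" if "ON T" for T
    unfolding S(2) k_def using that bound by (intro Greatest_le_nat[of _ _ "CARD('n)"]) auto
  have fin: "finite S" using bound S by blast
  have "span S = UNIV"
  proof (rule ccontr)
    assume "span S \<noteq> UNIV"
    then obtain a where a: "a \<notin> span S" by auto
    \<comment> \<open>This is \<open>a\<close> minus its projection to the span of \<open>S\<close>:
      nonzero since \<open>a\<close> lies outside the span, and orthogonal to \<open>S\<close> for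
      the form.\<close>
    define b where "b = a - (\<Sum>x\<in>S. ?f x a *\<^sub>R x)"
    have "(\<Sum>x\<in>S. ?f x a *\<^sub>R x) \<in> span S"
      by (intro span_sum span_scale span_base)
    then have "b \<notin> span S"
      using a unfolding b_def by (metis diff_add_cancel span_add)
    then have b: "b \<noteq> 0" using span_zero by metis
    define c where "c = b /\<^sub>R sqrt (?f b b)"
    have orth: "?f x b = 0" if "x \<in> S" for x
      using coeff[OF S(1) fin order_refl that, of "\<lambda>x. ?f x a"]
      by (simp add: b_def matrix_vector_mult_diff_distrib inner_diff_right)
    have fbb: "?f b b > 0" using pos b by simp
    then have cc: "?f c c = 1"
      by (simp add: c_def matrix_vector_mult_scaleR flip: power2_eq_square)
         (simp add: field_simps flip: power2_eq_square)
    have xc: "?f x c = 0" "?f c x = 0" if "x \<in> S" for x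
      using orth[OF that] sym[of x c] by (simp_all add: c_def matrix_vector_mult_scaleR)
    have "ON (insert c S)"
      using S(1) cc xc unfolding ON_def by auto
    moreover have "c \<notin> S" using xc(1)[of c] cc by auto
    ultimately show False using max[of "insert c S"] fin by simp
  qed
  then have "card S = CARD('n)"
    using basis_card_eq_dim[of S UNIV] indep[OF S(1)] by simp
  then obtain g :: "'n \<Rightarrow> real^'n" where g: "bij_betw g UNIV S"
    using fin by (metis finite finite_same_card_bij)
  define B where "B = (\<chi> i j. g j $ i)"
  have "(transpose B ** M ** B) $ i $ j = ?f (g i) (g j)" for i j
  proof -
    have "column j (M ** B) = M *v g j"
      by (simp add: column_def matrix_matrix_mult_def matrix_vector_mult_def B_def)
    moreover have "transpose B $ i = g i"
      by (simp add: transpose_def B_def vec_eq_iff)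
    moreover have "(transpose B ** (M ** B)) $ i $ j = (transpose B $ i) \<bullet> column j (M ** B)"
      by (simp add: matrix_matrix_mult_def inner_vec_def column_def)
    ultimately show ?thesis
      by (simp only: matrix_mul_assoc[symmetric])
  qed
  moreover have "?f (g i) (g j) = of_bool (i = j)" for i j
  proof (cases "i = j")
    case False
    then have "g i \<noteq> g j" using g by (metis bij_betw_imp_inj_on injD)
    then show ?thesis using S(1) bij_betwE[OF g] False by (simp add: ON_def)
  qed (use S(1) bij_betwE[OF g] in \<open>simp add: ON_def\<close>)
  ultimately have "transpose B ** M ** B = mat 1"
    by (simp add: vec_eq_iff mat_def)
  then show thesis by (rule that)
qed

lemma sym_pos_def_invertible:
  fixes C :: "real^'n^'n"
  assumes "sym_pos_def C"
  shows "invertible C"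
proof -
  have "x = 0" if "C *v x = 0" for x
    using assms that by (metis inner_zero_right less_irrefl sym_pos_def_def)
  then show ?thesis
    by (metis invertible_left_inverse matrix_left_invertible_ker)
qed

lemma invertible_matrix_inv:
  assumes "invertible A"
  shows "A ** matrix_inv A = mat 1" "matrix_inv A ** A = mat 1"
  using assms unfolding invertible_def matrix_inv_def
  by (metis (mono_tags, lifting) someI_ex)+

lemma matrix_inv_vector:
  fixes C :: "real^'n^'n"
  assumes "sym_pos_def C"
  shows "C *v (matrix_inv C *v x) = x" "matrix_inv C *v (C *v x) = x"
  using invertible_matrix_inv[OF sym_pos_def_invertible[OF assms]]
  by (simp_all add: matrix_vector_mul_assoc)

text \<open>Writing \<open>x = C y\<close> turns the quadratic form of the inverse into that of
  \<open>C\<close>. Symmetry holds because the transpose of the inverse is again an inverse of the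
  symmetric matrix \<open>C\<close>.\<close>

lemma sym_pos_def_matrix_inv:
  fixes C :: "real^'n^'n"
  assumes "sym_pos_def C"
  shows "sym_pos_def (matrix_inv C)"
  unfolding sym_pos_def_def
proof (intro conjI allI impI)
  let ?V = "matrix_inv C"
  have inv: "C ** ?V = mat 1" "?V ** C = mat 1"
    using invertible_matrix_inv[OF sym_pos_def_invertible[OF assms]] by auto
  have "C ** transpose ?V = mat 1"
    using assms inv by (metis matrix_transpose_mul sym_pos_def_def transpose_mat)
  then show "transpose ?V = ?V"
    by (metis inv(2) matrix_mul_assoc matrix_mul_lid matrix_mul_rid)
  fix x :: "real^'n" assume "x \<noteq> 0"
  then have "?V *v x \<noteq> 0" using matrix_inv_vector(1)[OF assms, of x] by auto
  then have "(?V *v x) \<bullet> (C *v (?V *v x)) > 0" using assms by (simp add: sym_pos_def_def)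
  then show "x \<bullet> (?V *v x) > 0"
    by (simp add: matrix_inv_vector[OF assms] inner_commute)
qed

text \<open>Bringing the inverse of \<open>C\<close> to the identity by congruence and solving for
  \<open>C\<close> gives a square factor, through which a Gaussian with covariance \<open>C\<close>
  becomes a linear image of the standard one.\<close>

lemma pos_def_factorization:
  fixes C :: "real^'n^'n"
  assumes "sym_pos_def C"
  obtains B :: "real^'n^'n" where "C = B ** transpose B"
proof -
  obtain B :: "real^'n^'n" where B: "transpose B ** matrix_inv C ** B = mat 1"
    using pos_def_congruent_identity[OF sym_pos_def_matrix_inv[OF assms]] .
  have "B ** (transpose B ** matrix_inv C) = mat 1"
    using B by (metis matrix_left_right_inverse)
  then have "C = B ** transpose B"
    using invertible_matrix_inv[OF sym_pos_def_invertible[OF assms]]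
    by (metis matrix_mul_assoc matrix_mul_lid matrix_mul_rid)
  then show thesis by (rule that)
qed

section \<open>Gaussian measures\<close>

lemma mvn_density_borel_measurable [measurable]: "mvn_density m C \<in> borel_measurable borel"
  unfolding mvn_density_def[abs_def] by measurable

lemma sets_mvn [simp, measurable_cong]: "sets (mvn m C) = sets borel"
  and space_mvn [simp]: "space (mvn m C) = UNIV"
  by (simp_all add: mvn_def)

text \<open>The integrand factors over the coordinates. The rate \<open>a\<close> is free because
  \<open>1 / 2\<close> serves the normalization of the standard Gaussian and \<open>1 / 4\<close>
  the bound on its second moment.\<close>

lemma nn_integral_exp_neg_inner:
  assumes "a > 0"
  shows "(\<integral>\<^sup>+z. ennreal (exp (- (a * (z \<bullet> z)))) \<partial>(lborel :: (real^'n) measure)) = ennreal (sqrt (pi / a) ^ CARD('n))"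
proof -
  \<comment> \<open>With this deviation the one-dimensional normal density is
    \<open>exp (- (a * x\<^sup>2))\<close> divided by \<open>sqrt (pi / a)\<close>.\<close>
  define \<sigma> where "\<sigma> = sqrt (1 / (2 * a))"
  have \<sigma>: "\<sigma> > 0" "\<sigma>\<^sup>2 = 1 / (2 * a)" using assms by (simp_all add: \<sigma>_def)
  have "(\<integral>\<^sup>+x. ennreal (exp (- (a * x\<^sup>2))) \<partial>lborel) =
        (\<integral>\<^sup>+x. ennreal (sqrt (pi / a)) * ennreal (normal_density 0 \<sigma> x) \<partial>lborel)"
    using assms \<sigma> by (intro nn_integral_cong)
      (simp add: normal_density_def real_sqrt_divide flip: ennreal_mult')
  also have "\<dots> = ennreal (sqrt (pi / a)) * (\<integral>\<^sup>+x. ennreal (normal_density 0 \<sigma> x) \<partial>lborel)"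
    by (rule nn_integral_cmult) simp
  also have "(\<integral>\<^sup>+x. ennreal (normal_density 0 \<sigma> x) \<partial>lborel) = 1"
    using \<sigma> by (subst nn_integral_eq_integral) auto
  finally have one: "(\<integral>\<^sup>+x. ennreal (exp (- (a * x\<^sup>2))) \<partial>lborel) = ennreal (sqrt (pi / a))"
    by simp
  have "(\<integral>\<^sup>+z. ennreal (exp (- (a * (z \<bullet> z)))) \<partial>(lborel :: (real^'n) measure)) =
        (\<integral>\<^sup>+z. (\<Prod>b\<in>Basis. ennreal (exp (- (a * (z \<bullet> b)\<^sup>2)))) \<partial>(lborel :: (real^'n) measure))"
    by (intro nn_integral_cong)
       (simp add: prod_ennreal exp_sum[symmetric] sum_negf sum_distrib_left[symmetric]
          euclidean_inner[of x x for x] power2_eq_square)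
  also have "\<dots> = (\<Prod>b\<in>(Basis :: (real^'n) set). ennreal (sqrt (pi / a)))"
    by (subst nn_integral_lborel_prod[where f="\<lambda>_ x. ennreal (exp (- (a * x\<^sup>2)))"]) (simp_all add: one)
  finally show ?thesis using assms by (simp add: ennreal_power)
qed

lemma sym_pos_def_mat_1: "sym_pos_def (mat 1)"
  by (simp add: sym_pos_def_def)

lemma mvn_std_density:
  "mvn_density 0 (mat 1) z = exp (- ((1 / 2) * (z \<bullet> z))) / sqrt (2 * pi) ^ CARD('n)" for z :: "real^'n"
  using matrix_inv_vector(2)[OF sym_pos_def_mat_1, of z]
  unfolding mvn_density_def det_I mult_1_right real_sqrt_power by simp

lemma prob_space_mvn_std: "prob_space (mvn 0 (mat 1) :: (real^'n) measure)"
proof (rule prob_spaceI)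
  let ?c = "sqrt (2 * pi) ^ CARD('n)"
  have pos: "?c > 0" by simp
  have "emeasure (mvn 0 (mat 1) :: (real^'n) measure) UNIV =
        (\<integral>\<^sup>+z. ennreal (mvn_density 0 (mat 1) z) \<partial>(lborel :: (real^'n) measure))"
    unfolding mvn_def by (subst emeasure_density) simp_all
  also have "\<dots> = (\<integral>\<^sup>+z. ennreal (exp (- ((1 / 2) * (z \<bullet> z)))) * ennreal (1 / ?c) \<partial>(lborel :: (real^'n) measure))"
    unfolding mvn_std_density
    by (intro nn_integral_cong, subst ennreal_mult'[symmetric]) simp_all
  also have "\<dots> = (\<integral>\<^sup>+z. ennreal (exp (- ((1 / 2) * (z \<bullet> z)))) \<partial>(lborel :: (real^'n) measure)) * ennreal (1 / ?c)"
    by (rule nn_integral_multc) measurable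
  also have "\<dots> = ennreal ?c * ennreal (1 / ?c)"
    by (subst nn_integral_exp_neg_inner) (simp_all add: mult.commute)
  also have "\<dots> = 1"
    using pos by (subst ennreal_mult'[symmetric]) (simp_all del: zero_less_power)
  finally show "emeasure (mvn 0 (mat 1) :: (real^'n) measure) (space (mvn 0 (mat 1))) = 1" by simp
qed

text \<open>Half of the exponent absorbs the square: with \<open>t = z \<bullet> z\<close>, the
  bound \<open>t / 4 \<le> exp (t / 4)\<close> leaves the integrable factor
  \<open>exp (- (t / 4))\<close>.\<close>

lemma mvn_std_integrable_norm_square:
  "integrable (mvn 0 (mat 1)) (\<lambda>z::real^'n. (norm z)\<^sup>2)"
proof -
  let ?c = "sqrt (2 * pi) ^ CARD('n)"
  have "integrable lborel (\<lambda>z::real^'n. exp (- ((1 / 4) * (z \<bullet> z))))"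
    by (rule integrableI_nonneg) (auto simp: nn_integral_exp_neg_inner[of "1 / 4", simplified])
  then have "integrable lborel (\<lambda>z::real^'n. exp (- ((1 / 4) * (z \<bullet> z))) * (4 / ?c))"
    by (rule integrable_mult_left)
  then have "integrable lborel (\<lambda>z::real^'n. mvn_density 0 (mat 1) z *\<^sub>R (norm z)\<^sup>2)"
  proof (rule Bochner_Integration.integrable_bound, measurable, intro AE_I2)
    fix z :: "real^'n"
    let ?t = "z \<bullet> z"
    have "?t / 4 \<le> exp (?t / 4)" using exp_ge_add_one_self[of "?t/4"] by linarith
    then have "exp (- (?t / 2)) * (?t / 4) \<le> exp (- (?t / 2)) * exp (?t / 4)" by simp
    also have "\<dots> = exp (- (?t / 4))" by (simp flip: exp_add)
    finally have "exp (- (?t / 2)) * ?t \<le> exp (- (?t / 4)) * 4" by simp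
    then show "norm (mvn_density 0 (mat 1) z *\<^sub>R (norm z)\<^sup>2) \<le> norm (exp (- ((1 / 4) * (z \<bullet> z))) * (4 / ?c))"
      by (simp add: mvn_std_density power2_norm_eq_inner divide_right_mono)
  qed
  then show ?thesis
    unfolding mvn_def by (subst integrable_density) (auto simp: mvn_std_density)
qed

text \<open>Substituting \<open>x = m + B z\<close> turns the quadratic form in the density into
  \<open>z \<bullet> z\<close>, and the Jacobian \<open>\<bar>det B\<bar>\<close> cancels the square
  root of \<open>det C\<close>. Questions about \<open>mvn\<close> thereby reduce to the standard
  Gaussian.\<close>

lemma mvn_eq_distr_std:
  fixes B :: "real^'n^'n"
  assumes C: "sym_pos_def C" "C = B ** transpose B"
  shows "mvn m C = distr (mvn 0 (mat 1)) borel (\<lambda>z. m + B *v z)"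
proof -
  let ?T = "\<lambda>z. m + B *v z"
  let ?V = "matrix_inv C"
  \<comment> \<open>For square matrices a right inverse is also a left inverse, so the same three
    factors may be rotated into \<open>transpose B ** ?V ** B = mat 1\<close>.\<close>
  have "B ** (transpose B ** ?V) = mat 1"
    using C(2) invertible_matrix_inv[OF sym_pos_def_invertible[OF C(1)]]
    by (metis matrix_mul_assoc)
  then have 1: "transpose B ** (?V ** B) = mat 1" and inv: "invertible B"
    by (metis matrix_left_right_inverse matrix_mul_assoc, metis invertible_right_inverse)
  have det: "det C = (det B)\<^sup>2" "det B \<noteq> 0"
    using inv by (simp_all add: C(2) det_mul power2_eq_square invertible_det_nz)
  have quad: "(B *v z) \<bullet> (?V *v (B *v z)) = z \<bullet> z" for z
  proof -
    have "(B *v z) \<bullet> (?V *v (B *v z)) = z \<bullet> (transpose B *v (?V *v (B *v z)))"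
      by (metis dot_lmul_matrix inner_commute transpose_matrix_vector)
    then show ?thesis using 1 by (simp add: matrix_vector_mul_assoc del: transpose_matrix_vector)
  qed
  have "sqrt ((2 * pi) ^ CARD('n) * det C) = sqrt (2 * pi) ^ CARD('n) * \<bar>det B\<bar>"
    unfolding det(1) real_sqrt_mult real_sqrt_abs real_sqrt_power[of "2 * pi", unfolded real_sqrt_mult] ..
  then have dens: "mvn_density m C (?T z) * \<bar>det B\<bar> = mvn_density 0 (mat 1) z" for z
    using det(2) by (simp add: mvn_density_def[of m] mvn_std_density quad)
  have T[measurable]: "?T \<in> borel \<rightarrow>\<^sub>M borel" by measurable
  have "lborel = distr lborel borel ((+) m)" by (simp add: lborel_distr_plus)
  also have "\<dots> = distr (density (distr lborel borel (\<lambda>x. B *v x)) (\<lambda>_. ennreal \<bar>det B\<bar>)) borel ((+) m)"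
    using lborel_eq_density_distr_matrix[OF det(2)] by simp
  also have "\<dots> = density (distr (distr lborel borel (\<lambda>x. B *v x)) borel ((+) m)) (\<lambda>_. ennreal \<bar>det B\<bar>)"
    by (rule density_distr[symmetric]) auto
  also have "\<dots> = density (distr lborel borel ?T) (\<lambda>_. ennreal \<bar>det B\<bar>)"
    by (subst distr_distr) (auto simp: o_def)
  finally have "mvn m C = density (density (distr lborel borel ?T) (\<lambda>_. ennreal \<bar>det B\<bar>)) (\<lambda>x. ennreal (mvn_density m C x))"
    by (simp add: mvn_def)
  also have "\<dots> = density (distr lborel borel ?T) (\<lambda>x. ennreal (mvn_density m C x * \<bar>det B\<bar>))"
    by (subst density_density_eq) (auto simp: ennreal_mult' mult.commute)
  also have "\<dots> = distr (density lborel (\<lambda>z. ennreal (mvn_density m C (?T z) * \<bar>det B\<bar>))) borel ?T"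
    by (rule density_distr) auto
  also have "\<dots> = distr (mvn 0 (mat 1)) borel ?T"
    by (simp add: dens mvn_def)
  finally show ?thesis .
qed

lemma prob_space_mvn:
  fixes C :: "real^'n^'n"
  assumes "sym_pos_def C"
  shows "prob_space (mvn m C)"
proof -
  obtain B :: "real^'n^'n" where B: "C = B ** transpose B" using pos_def_factorization[OF assms] .
  show ?thesis
    unfolding mvn_eq_distr_std[OF assms B]
    by (intro prob_space.prob_space_distr[OF prob_space_mvn_std]) measurable
qed

lemma distr_mvn_inner_std:
  fixes B :: "real^'n^'n"
  assumes C: "sym_pos_def C" "C = B ** transpose B"
  shows "distr (mvn m C) borel (\<lambda>x. w \<bullet> x) = distr (mvn 0 (mat 1)) borel (\<lambda>z. w \<bullet> m + (transpose B *v w) \<bullet> z)"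
  unfolding mvn_eq_distr_std[OF C]
  by (subst distr_distr) (auto simp: o_def inner_add_right dot_lmul_matrix)

text \<open>Rotation invariance: some orthogonal \<open>Q\<close> maps \<open>u'\<close> to
  \<open>u\<close>, and \<open>mat 1 = Q ** transpose Q\<close> is a factorization of the identity
  covariance to which \<open>distr_mvn_inner_std\<close> applies.\<close>

lemma distr_mvn_std_inner_cong:
  fixes u u' :: "real^'n"
  assumes "norm u = norm u'"
  shows "distr (mvn 0 (mat 1)) borel (\<lambda>z. u \<bullet> z) = distr (mvn 0 (mat 1)) borel (\<lambda>z. u' \<bullet> z)"
proof -
  obtain f where f: "orthogonal_transformation f" "f u' = u"
    using orthogonal_transformation_exists[of u' u] assms by metis
  define Q where "Q = matrix f"
  have Q: "orthogonal_matrix Q" "Q *v u' = u"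
    using f by (auto simp: Q_def orthogonal_transformation_matrix)
  have "mat 1 = Q ** transpose Q" using Q(1) by (simp add: orthogonal_matrix_def)
  then have "distr (mvn 0 (mat 1)) borel (\<lambda>z. u \<bullet> z) = distr (mvn 0 (mat 1)) borel (\<lambda>z. (transpose Q *v u) \<bullet> z)"
    using distr_mvn_inner_std[OF sym_pos_def_mat_1, of Q 0 u] by simp
  also have "transpose Q *v u = u'"
    unfolding Q(2)[symmetric] using Q(1)
    by (simp add: matrix_vector_mul_assoc orthogonal_matrix_def del: transpose_matrix_vector)
  finally show ?thesis .
qed

text \<open>The law of \<open>w \<bullet> x\<close> is a translate by \<open>w \<bullet> m\<close>
  of a standard Gaussian marginal along \<open>transpose B *v w\<close>, whose squared norm is the
  variance. This serves both to fold the class with label 0 onto the other and to reflect a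
  minimizer.\<close>

lemma distr_mvn_inner_cong:
  fixes w w' :: "real^'n"
  assumes C: "sym_pos_def C" and C': "sym_pos_def C'"
    and mean: "w \<bullet> m = w' \<bullet> m'" and var: "w \<bullet> (C *v w) = w' \<bullet> (C' *v w')"
  shows "distr (mvn m C) borel (\<lambda>x. w \<bullet> x) = distr (mvn m' C') borel (\<lambda>x. w' \<bullet> x)"
proof -
  obtain B :: "real^'n^'n" where B: "C = B ** transpose B" using pos_def_factorization[OF C] .
  obtain B' :: "real^'n^'n" where B': "C' = B' ** transpose B'" using pos_def_factorization[OF C'] .
  have norm: "w \<bullet> ((B ** transpose B) *v w) = (norm (transpose B *v w))\<^sup>2" for B :: "real^'n^'n" and w
    by (simp add: power2_norm_eq_inner dot_lmul_matrix matrix_vector_mul_assoc[symmetric])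
  let ?u = "transpose B *v w" and ?u' = "transpose B' *v w'"
  have "norm ?u = norm ?u'"
    using var unfolding B B' norm by (simp add: power2_eq_iff_nonneg)
  then have "distr (distr (mvn 0 (mat 1)) borel (\<lambda>z. ?u \<bullet> z)) borel ((+) (w \<bullet> m)) =
        distr (distr (mvn 0 (mat 1)) borel (\<lambda>z. ?u' \<bullet> z)) borel ((+) (w' \<bullet> m'))"
    using mean distr_mvn_std_inner_cong by metis
  then show ?thesis
    unfolding distr_mvn_inner_std[OF C B] distr_mvn_inner_std[OF C' B']
    by (subst (asm) (1 2) distr_distr) (auto simp: o_def simp del: transpose_matrix_vector)
qed

lemma mvn_integrable_inner_square:
  fixes w :: "real^'n"
  assumes C: "sym_pos_def C"
  shows "integrable (mvn m C) (\<lambda>x. (w \<bullet> x)\<^sup>2)"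
proof -
  obtain B :: "real^'n^'n" where B: "C = B ** transpose B" using pos_def_factorization[OF C] .
  let ?u = "transpose B *v w"
  interpret prob_space "mvn 0 (mat 1) :: (real^'n) measure" by (rule prob_space_mvn_std)
  have "integrable (mvn 0 (mat 1)) (\<lambda>z::real^'n. 2 * (w \<bullet> m)\<^sup>2 + 2 * (norm ?u)\<^sup>2 * (norm z)\<^sup>2)"
    using mvn_std_integrable_norm_square by (intro Bochner_Integration.integrable_add integrable_mult_right) auto
  then have "integrable (mvn 0 (mat 1)) (\<lambda>z. (w \<bullet> m + ?u \<bullet> z)\<^sup>2)"
  proof (rule Bochner_Integration.integrable_bound, measurable, intro AE_I2)
    fix z
    have "(w \<bullet> m + ?u \<bullet> z)\<^sup>2 \<le> 2 * (w \<bullet> m)\<^sup>2 + 2 * (?u \<bullet> z)\<^sup>2"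
      using sum_squares_bound[of "w \<bullet> m" "?u \<bullet> z"] by (simp add: power2_sum)
    also have "(?u \<bullet> z)\<^sup>2 \<le> (norm ?u * norm z)\<^sup>2"
      by (metis Cauchy_Schwarz_ineq2 abs_ge_zero power2_abs power_mono)
    finally show "norm ((w \<bullet> m + ?u \<bullet> z)\<^sup>2) \<le> norm (2 * (w \<bullet> m)\<^sup>2 + 2 * (norm ?u)\<^sup>2 * (norm z)\<^sup>2)"
      by (simp add: power_mult_distrib)
  qed
  then have "integrable (distr (mvn 0 (mat 1)) borel (\<lambda>z. w \<bullet> m + ?u \<bullet> z)) (\<lambda>t. t\<^sup>2)"
    by (subst integrable_distr_eq) auto
  then show ?thesis
    unfolding distr_mvn_inner_std[OF C B, symmetric] by (subst (asm) integrable_distr_eq) auto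
qed

lemma mvn_integrable_inner:
  assumes C: "sym_pos_def C"
  shows "integrable (mvn m C) (\<lambda>x. w \<bullet> x)"
proof -
  interpret prob_space "mvn m C" by (rule prob_space_mvn[OF C])
  show ?thesis
    by (rule square_integrable_imp_integrable[OF _ mvn_integrable_inner_square[OF C]]) simp
qed

lemma mvn_integral_inner:
  fixes w :: "real^'n"
  assumes C: "sym_pos_def C"
  shows "(\<integral>x. w \<bullet> x \<partial>mvn m C) = w \<bullet> m"
proof -
  obtain B :: "real^'n^'n" where B: "C = B ** transpose B" using pos_def_factorization[OF C] .
  let ?u = "transpose B *v w"
  let ?\<gamma> = "mvn 0 (mat 1) :: (real^'n) measure"
  interpret prob_space ?\<gamma> by (rule prob_space_mvn_std)
  have int: "integrable ?\<gamma> (\<lambda>z. ?u \<bullet> z)"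
    by (rule mvn_integrable_inner[OF sym_pos_def_mat_1])
  \<comment> \<open>The centred part has the same law as its negative, so its mean equals its own
    negative and vanishes.\<close>
  have neg: "distr ?\<gamma> borel (\<lambda>z. ?u \<bullet> z) = distr ?\<gamma> borel (\<lambda>z. (- ?u) \<bullet> z)"
    by (rule distr_mvn_std_inner_cong) simp
  have "(\<integral>z. ?u \<bullet> z \<partial>?\<gamma>) = (\<integral>t. t \<partial>distr ?\<gamma> borel (\<lambda>z. ?u \<bullet> z))"
    by (subst integral_distr) (auto simp del: transpose_matrix_vector)
  also have "\<dots> = (\<integral>t. t \<partial>distr ?\<gamma> borel (\<lambda>z. (- ?u) \<bullet> z))"
    by (simp only: neg)
  also have "\<dots> = (\<integral>z. (- ?u) \<bullet> z \<partial>?\<gamma>)"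
    by (rule integral_distr) measurable
  also have "\<dots> = - (\<integral>z. ?u \<bullet> z \<partial>?\<gamma>)"
    by (simp only: inner_minus_left Bochner_Integration.integral_minus)
  finally have zero: "(\<integral>z. ?u \<bullet> z \<partial>?\<gamma>) = 0" by simp
  have "(\<integral>x. w \<bullet> x \<partial>mvn m C) = (\<integral>t. t \<partial>distr (mvn m C) borel (\<lambda>x. w \<bullet> x))"
    by (subst integral_distr) auto
  also have "\<dots> = (\<integral>z. w \<bullet> m + ?u \<bullet> z \<partial>?\<gamma>)"
    unfolding distr_mvn_inner_std[OF C B]
    by (subst integral_distr) (auto simp del: transpose_matrix_vector)
  also have "\<dots> = w \<bullet> m"
    using int zero prob_space by (simp del: transpose_matrix_vector)
  finally show ?thesis .
qed

text \<open>The density is positive everywhere, so a Gaussian null set is a Lebesgue null set; an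
  open one, here the complement of \<open>S\<close>, must be empty.\<close>

lemma mvn_AE_closed:
  fixes m :: "real^'n"
  assumes "sym_pos_def C" "AE x in mvn m C. x \<in> S" "closed S"
  shows "S = UNIV"
proof -
  obtain B :: "real^'n^'n" where B: "C = B ** transpose B" using pos_def_factorization[OF assms(1)] .
  have "det C \<noteq> 0" using sym_pos_def_invertible[OF assms(1)] by (simp add: invertible_det_nz)
  then have "det C > 0" by (simp add: B det_mul zero_less_mult_iff not_less less_le)
  then have "mvn_density m C x > 0" for x
    unfolding mvn_density_def by (intro divide_pos_pos) auto
  then have "AE x in lborel. x \<in> S"
    using assms(2) unfolding mvn_def by (subst (asm) AE_density) auto
  then have "AE x in lebesgue. x \<in> S"
    by (rule AE_completion)
  then have "x \<in> S" for x
    by (rule mem_closed_if_AE_lebesgue[OF assms(3)])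
  then show ?thesis by blast
qed

section \<open>The expected loss as a Gaussian integral\<close>

lemma logistic_loss_nonneg: "0 \<le> logistic_loss z"
  by (simp add: logistic_loss_def)

lemma logistic_loss_zero: "logistic_loss 0 = ln 2"
  by (simp add: logistic_loss_def)

lemma logistic_loss_ge_neg: "- z \<le> logistic_loss z"
proof -
  have "ln (exp (- z)) \<le> ln (1 + exp (- z))" by (subst ln_le_cancel_iff) (auto intro: add_pos_pos)
  then show ?thesis by (simp add: logistic_loss_def)
qed

lemma logistic_loss_le_abs: "logistic_loss z \<le> ln 2 + \<bar>z\<bar>"
proof -
  have "1 + exp (- z) \<le> 2 * exp \<bar>z\<bar>"
    using exp_le_cancel_iff[of "- z" "\<bar>z\<bar>"] one_le_exp_iff[of "\<bar>z\<bar>"] by linarith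
  then have "ln (1 + exp (- z)) \<le> ln (2 * exp \<bar>z\<bar>)"
    by (subst ln_le_cancel_iff) (auto intro: add_pos_pos)
  then show ?thesis by (simp add: logistic_loss_def ln_mult)
qed

lemma logistic_loss_has_derivative:
  "(logistic_loss has_real_derivative - (1 / (1 + exp z))) (at z)"
proof -
  have "1 + exp (- z) > 0" "1 + exp z > 0" by (auto intro: add_pos_pos)
  moreover have "exp (- z) / (1 + exp (- z)) = 1 / (1 + exp z)"
    using calculation by (simp add: exp_minus field_simps)
  ultimately show ?thesis
    unfolding logistic_loss_def[abs_def]
    by (auto intro!: derivative_eq_intros)
qed

lemma continuous_on_logistic_loss [continuous_intros]:
  "continuous_on S f \<Longrightarrow> continuous_on S (\<lambda>x. logistic_loss (f x))"
  by (rule continuous_on_compose2[of UNIV logistic_loss])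
     (auto intro: continuous_at_imp_continuous_on DERIV_isCont logistic_loss_has_derivative)

lemma logistic_loss_measurable [measurable]: "logistic_loss \<in> borel_measurable borel"
  by (intro borel_measurable_continuous_onI continuous_intros)

lemma convex_logistic_loss: "convex_on UNIV logistic_loss"
proof (rule convex_on_realI)
  show "- (1 / (1 + exp x)) \<le> - (1 / (1 + exp y))" if "x \<le> y" for x y :: real
    using that by (simp add: frac_le add_pos_pos)
qed (auto intro: logistic_loss_has_derivative)

text \<open>In terms of \<open>p\<close> and \<open>q\<close>, the exponentials at half the
  arguments, the claim is \<open>(1 + p * q)\<^sup>2 < (1 + p\<^sup>2) * (1 + q\<^sup>2)\<close>,
  where the two sides differ by \<open>(p - q)\<^sup>2\<close>. Strictness at midpoints is what
  uniqueness of the minimizer draws on.\<close>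

lemma logistic_loss_midpoint_less:
  assumes "a \<noteq> b"
  shows "logistic_loss ((a + b) / 2) < (logistic_loss a + logistic_loss b) / 2"
proof -
  define p q where "p = exp (- a / 2)" and "q = exp (- b / 2)"
  have pq: "p > 0" "q > 0" "p \<noteq> q" "exp (- a) = p\<^sup>2" "exp (- b) = q\<^sup>2" "exp (- ((a + b) / 2)) = p * q"
    using assms by (auto simp: p_def q_def power2_eq_square add_divide_distrib simp flip: exp_add)
  have "0 < (p - q)\<^sup>2" using pq by simp
  then have "(1 + p * q)\<^sup>2 < (1 + p\<^sup>2) * (1 + q\<^sup>2)"
    by (simp add: power2_eq_square algebra_simps)
  moreover have pos: "1 + p * q > 0" "1 + p\<^sup>2 > 0" "1 + q\<^sup>2 > 0"
    using pq by (auto intro: add_pos_pos)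
  ultimately have "ln ((1 + p * q)\<^sup>2) < ln ((1 + p\<^sup>2) * (1 + q\<^sup>2))"
    by (subst ln_less_cancel_iff) auto
  then have "2 * ln (1 + p * q) < ln (1 + p\<^sup>2) + ln (1 + q\<^sup>2)"
    using pos by (simp add: ln_mult ln_realpow)
  then show ?thesis by (simp add: logistic_loss_def pq)
qed

lemma logistic_loss_ge_tangent: "ln 2 - z / 2 \<le> logistic_loss z"
  using convex_on_imp_above_tangent[OF convex_logistic_loss, of 0 z "- (1 / 2)"]
    logistic_loss_has_derivative[of 0]
  by (simp add: logistic_loss_zero)

text \<open>The second derivative of the loss is at most 1, so \<open>z\<^sup>2 / 2\<close> minus
  the loss is convex and lies above its tangent at 0, which has slope \<open>1 / 2\<close>.\<close>

lemma logistic_loss_le_quadratic: "logistic_loss z \<le> ln 2 - z / 2 + z\<^sup>2 / 2"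
proof -
  let ?f = "\<lambda>z. z\<^sup>2 / 2 - logistic_loss z"
  have deriv: "(?f has_real_derivative z + 1 / (1 + exp z)) (at z)" for z
    by (auto intro!: derivative_eq_intros logistic_loss_has_derivative)
  have "convex_on UNIV ?f"
  proof (rule f''_ge0_imp_convex)
    fix z :: real
    have pos: "1 + exp z > 0" by (auto intro: add_pos_pos)
    show "((\<lambda>z. z + 1 / (1 + exp z)) has_real_derivative 1 - exp z / (1 + exp z)\<^sup>2) (at z)"
      using pos by (auto intro!: derivative_eq_intros simp: power2_eq_square)
    have "exp z \<le> (1 + exp z)\<^sup>2" using zero_le_power2[of "exp z"] by (simp add: power2_sum)
    then show "0 \<le> 1 - exp z / (1 + exp z)\<^sup>2" using pos by simp
  qed (use deriv in auto)
  from convex_on_imp_above_tangent[OF this, of 0 z "1 / 2"] deriv[of 0]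
  show ?thesis by (simp add: logistic_loss_zero)
qed

section \<open>Reduction of the expected loss to a single Gaussian\<close>

definition logistic_risk :: "real^'d \<Rightarrow> real^'d^'d \<Rightarrow> real^'d \<Rightarrow> real" where
  "logistic_risk m C w = (\<integral>x. logistic_loss (w \<bullet> x) \<partial>mvn m C)"

lemma integrable_logistic_loss:
  assumes C: "sym_pos_def C"
  shows "integrable (mvn m C) (\<lambda>x. logistic_loss (w \<bullet> x))"
proof -
  interpret prob_space "mvn m C" by (rule prob_space_mvn[OF C])
  have "integrable (mvn m C) (\<lambda>x. ln 2 + \<bar>w \<bullet> x\<bar>)"
    using mvn_integrable_inner[OF C] by auto
  then show ?thesis
    using logistic_loss_le_abs logistic_loss_nonneg
    by (rule_tac Bochner_Integration.integrable_bound) (auto intro!: AE_I2 intro: order_trans)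
qed

text \<open>Given label 1 the integrand is the loss of \<open>w \<bullet> x\<close> under mean
  \<open>\<mu>\<close>. Given label 0 it is the loss of \<open>- (w \<bullet> x)\<close> under mean
  \<open>- \<mu>\<close>, a variable with the same law, so both halves of the mixture contribute the
  same value.\<close>

lemma
  fixes \<mu> :: "real^'d" and \<Sigma> :: "real^'d^'d"
  assumes C: "sym_pos_def ((1 / \<kappa>) *\<^sub>R \<Sigma>)"
  shows prob_space_data_dist: "prob_space (data_dist \<mu> \<Sigma> \<kappa>)"
    and has_bochner_integral_data_dist: "has_bochner_integral (data_dist \<mu> \<Sigma> \<kappa>)
           (\<lambda>z. real (snd z) * logistic_loss (w \<bullet> fst z) + (1 - real (snd z)) * logistic_loss (- (w \<bullet> fst z)))
           (logistic_risk \<mu> ((1 / \<kappa>) *\<^sub>R \<Sigma>) w)"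
proof -
  let ?C = "(1 / \<kappa>) *\<^sub>R \<Sigma>"
  let ?N = "borel \<Otimes>\<^sub>M count_space UNIV :: ((real^'d) \<times> nat) measure"
  let ?g = "\<lambda>z :: (real^'d) \<times> nat. real (snd z) * logistic_loss (w \<bullet> fst z) + (1 - real (snd z)) * logistic_loss (- (w \<bullet> fst z))"
  define K where "K y = distr (mvn (if y = 1 then \<mu> else - \<mu>) ?C) ?N (\<lambda>x. (x, y))" for y :: nat
  have D: "data_dist \<mu> \<Sigma> \<kappa> = measure_pmf (pmf_of_set {0, 1}) \<bind> K"
    by (simp add: data_dist_def K_def[abs_def])
  have prob: "prob_space (K y)" for y
    unfolding K_def by (rule prob_space.prob_space_distr[OF prob_space_mvn[OF C]]) measurable
  have K: "K \<in> measure_pmf (pmf_of_set {0, 1}) \<rightarrow>\<^sub>M subprob_algebra ?N"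
    using prob by (auto simp: space_subprob_algebra prob_space_imp_subprob_space K_def)
  have g[measurable]: "?g \<in> borel_measurable ?N" by measurable
  show "prob_space (data_dist \<mu> \<Sigma> \<kappa>)"
    unfolding D by (rule measure_pmf.prob_space_bind[OF _ K]) (simp add: prob)
  have sets: "sets (data_dist \<mu> \<Sigma> \<kappa>) = sets ?N"
    unfolding D by (rule sets_bind[OF _ ]) (auto simp: K_def)
  \<comment> \<open>Labels are natural numbers, and for labels above 1 the factor
    \<open>1 - real (snd z)\<close> is negative. Only almost surely is the integrand nonnegative, as
    the passage from the nonnegative integral to the Bochner integral requires.\<close>
  have "AE z in K y. snd z = y" for y
    unfolding K_def by (subst AE_distr_iff) auto
  then have "AE z in K y. snd z \<in> {0, 1}" if "y \<in> {0, 1}" for y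
    by (rule AE_mp) (use that in auto)
  then have "AE z in data_dist \<mu> \<Sigma> \<kappa>. snd z \<in> {0, 1}"
    unfolding D by (subst AE_bind[OF K]) (auto simp: AE_measure_pmf_iff)
  then have nonneg: "AE z in data_dist \<mu> \<Sigma> \<kappa>. 0 \<le> ?g z"
    by eventually_elim (auto simp: logistic_loss_nonneg)
  have G: "(\<integral>\<^sup>+x. ennreal (logistic_loss (w \<bullet> x)) \<partial>mvn \<mu> ?C) = ennreal (logistic_risk \<mu> ?C w)"
    unfolding logistic_risk_def
    by (rule nn_integral_eq_integral[OF integrable_logistic_loss[OF C]]) (simp add: logistic_loss_nonneg)
  have K1: "(\<integral>\<^sup>+z. ennreal (?g z) \<partial>K 1) = ennreal (logistic_risk \<mu> ?C w)"
    unfolding K_def by (subst nn_integral_distr) (auto simp: G)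
  have "(\<integral>\<^sup>+z. ennreal (?g z) \<partial>K 0) = (\<integral>\<^sup>+x. ennreal (logistic_loss ((- w) \<bullet> x)) \<partial>mvn (- \<mu>) ?C)"
    unfolding K_def by (subst nn_integral_distr) auto
  also have "\<dots> = (\<integral>\<^sup>+t. ennreal (logistic_loss t) \<partial>distr (mvn (- \<mu>) ?C) borel (\<lambda>x. (- w) \<bullet> x))"
    by (subst nn_integral_distr) auto
  also have "distr (mvn (- \<mu>) ?C) borel (\<lambda>x. (- w) \<bullet> x) = distr (mvn \<mu> ?C) borel (\<lambda>x. w \<bullet> x)"
    by (rule distr_mvn_inner_cong[OF C C])
       (auto simp: linear_neg[OF matrix_vector_mul_linear])
  also have "(\<integral>\<^sup>+t. ennreal (logistic_loss t) \<partial>distr (mvn \<mu> ?C) borel (\<lambda>x. w \<bullet> x)) = ennreal (logistic_risk \<mu> ?C w)"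
    by (subst nn_integral_distr) (auto simp: G)
  finally have K0: "(\<integral>\<^sup>+z. ennreal (?g z) \<partial>K 0) = ennreal (logistic_risk \<mu> ?C w)" .
  have R: "0 \<le> logistic_risk \<mu> ?C w"
    unfolding logistic_risk_def by (simp add: logistic_loss_nonneg)
  have "(\<integral>\<^sup>+z. ennreal (?g z) \<partial>data_dist \<mu> \<Sigma> \<kappa>) = (\<integral>\<^sup>+y. \<integral>\<^sup>+z. ennreal (?g z) \<partial>K y \<partial>measure_pmf (pmf_of_set {0, 1}))"
    unfolding D by (rule nn_integral_bind[OF _ K]) measurable
  also have "\<dots> = (ennreal (logistic_risk \<mu> ?C w) + ennreal (logistic_risk \<mu> ?C w)) / 2"
    using K0 K1 by (subst nn_integral_pmf_of_set) auto
  also have "\<dots> = ennreal (logistic_risk \<mu> ?C w)"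
    using R by (simp add: divide_ennreal flip: ennreal_plus ennreal_numeral)
  finally show "has_bochner_integral (data_dist \<mu> \<Sigma> \<kappa>) ?g (logistic_risk \<mu> ?C w)"
    using nonneg R by (intro has_bochner_integral_nn_integral) (auto simp: measurable_cong_sets[OF sets refl])
qed

text \<open>Each coordinate of the sample has law \<open>data_dist\<close>, so the \<open>n\<close>
  summands have the same expectation; with \<open>n \<ge> 1\<close> their sum cancels the factor
  \<open>1 / real n\<close>.\<close>

lemma expected_erm_loss_eq_logistic_risk:
  fixes \<mu> :: "real^'d" and \<Sigma> :: "real^'d^'d"
  assumes C: "sym_pos_def ((1 / \<kappa>) *\<^sub>R \<Sigma>)" and "n \<ge> 1"
  shows "expected_erm_loss \<mu> \<Sigma> \<kappa> n w = logistic_risk \<mu> ((1 / \<kappa>) *\<^sub>R \<Sigma>) w"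
proof -
  let ?D = "data_dist \<mu> \<Sigma> \<kappa>"
  let ?P = "Pi\<^sub>M {1..n} (\<lambda>_. ?D)"
  let ?G = "logistic_risk \<mu> ((1 / \<kappa>) *\<^sub>R \<Sigma>) w"
  let ?g = "\<lambda>z :: (real^'d) \<times> nat. real (snd z) * logistic_loss (w \<bullet> fst z) + (1 - real (snd z)) * logistic_loss (- (w \<bullet> fst z))"
  note hb = prob_space_data_dist[OF C] has_bochner_integral_data_dist[OF C]
  have "has_bochner_integral ?P (\<lambda>S. ?g (S i)) ?G" if i: "i \<in> {1..n}" for i
  proof -
    have "distr ?P ?D (\<lambda>S. S i) = ?D"
      using hb(1) i by (intro distr_PiM_component)
    then have "has_bochner_integral (distr ?P ?D (\<lambda>S. S i)) ?g ?G"
      using hb(2)[of \<mu> w] by simp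
    moreover have "?g \<in> borel_measurable ?D"
      by (rule borel_measurable_has_bochner_integral[OF hb(2)])
    moreover have "(\<lambda>S. S i) \<in> ?P \<rightarrow>\<^sub>M ?D"
      using i by (rule measurable_component_singleton)
    ultimately show ?thesis
      by (simp add: has_bochner_integral_iff integrable_distr_eq integral_distr)
  qed
  then have "has_bochner_integral ?P (\<lambda>S. (1 / real n) * (\<Sum>i=1..n. ?g (S i))) ((1 / real n) * (\<Sum>i=1..n. ?G))"
    by (intro has_bochner_integral_mult_right has_bochner_integral_sum)
  then have "has_bochner_integral (training_dist \<mu> \<Sigma> \<kappa> n) (\<lambda>S. erm_loss n S w) ?G"
    using \<open>n \<ge> 1\<close> by (simp add: erm_loss_def training_dist_def)
  then show ?thesis
    unfolding expected_erm_loss_def by (rule has_bochner_integral_integral_eq)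
qed

section \<open>Minimizers of the logistic risk\<close>

text \<open>A zero integral would make \<open>f\<close> vanish almost everywhere, hence on a closed
  set of full measure, which is the whole space. Strict convexity and coercivity both rest on
  this.\<close>

lemma mvn_integral_pos:
  fixes f :: "real^'n \<Rightarrow> real"
  assumes C: "sym_pos_def C" and int: "integrable (mvn m C) f"
    and cont: "continuous_on UNIV f" and nonneg: "\<And>x. 0 \<le> f x" and "f x0 \<noteq> 0"
  shows "0 < (\<integral>x. f x \<partial>mvn m C)"
proof (rule ccontr)
  assume "\<not> 0 < (\<integral>x. f x \<partial>mvn m C)"
  moreover have "0 \<le> (\<integral>x. f x \<partial>mvn m C)" using nonneg by (intro Bochner_Integration.integral_nonneg)
  ultimately have "(\<integral>x. f x \<partial>mvn m C) = 0" by linarith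
  then have "AE x in mvn m C. f x = 0"
    using integral_nonneg_eq_0_iff_AE[OF int] nonneg by simp
  then have "AE x in mvn m C. x \<in> {x. f x = 0}" by simp
  moreover have "closed {x. f x = 0}"
    using cont by (intro closed_Collect_eq continuous_intros) auto
  ultimately have "{x. f x = 0} = UNIV" by (rule mvn_AE_closed[OF C])
  then show False using \<open>f x0 \<noteq> 0\<close> by auto
qed

text \<open>Stated for a general \<open>\<phi>\<close> because it is applied to the logistic loss
  and to its homogeneous lower bound \<open>max 0 (- t)\<close>.\<close>

lemma convex_on_integral_inner:
  fixes \<phi> :: "real \<Rightarrow> real" and m :: "real^'n"
  assumes "convex_on UNIV \<phi>" and int: "\<And>w. integrable (mvn m C) (\<lambda>x. \<phi> (w \<bullet> x))"
  shows "convex_on UNIV (\<lambda>w. \<integral>x. \<phi> (w \<bullet> x) \<partial>mvn m C)"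
proof (rule convex_onI)
  fix t :: real and v w :: "real^'n" assume t: "0 < t" "t < 1"
  have "(\<integral>x. \<phi> (((1 - t) *\<^sub>R v + t *\<^sub>R w) \<bullet> x) \<partial>mvn m C)
      \<le> (\<integral>x. (1 - t) * \<phi> (v \<bullet> x) + t * \<phi> (w \<bullet> x) \<partial>mvn m C)"
  proof (rule integral_mono)
    fix x
    show "\<phi> (((1 - t) *\<^sub>R v + t *\<^sub>R w) \<bullet> x) \<le> (1 - t) * \<phi> (v \<bullet> x) + t * \<phi> (w \<bullet> x)"
      using convex_onD[OF assms(1), of t "v \<bullet> x" "w \<bullet> x"] t by (simp add: inner_add_left)
  qed (auto intro!: int Bochner_Integration.integrable_add)
  also have "\<dots> = (1 - t) * (\<integral>x. \<phi> (v \<bullet> x) \<partial>mvn m C) + t * (\<integral>x. \<phi> (w \<bullet> x) \<partial>mvn m C)"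
    by (subst Bochner_Integration.integral_add) (auto intro: int)
  finally show "(\<integral>x. \<phi> (((1 - t) *\<^sub>R v + t *\<^sub>R w) \<bullet> x) \<partial>mvn m C)
      \<le> (1 - t) * (\<integral>x. \<phi> (v \<bullet> x) \<partial>mvn m C) + t * (\<integral>x. \<phi> (w \<bullet> x) \<partial>mvn m C)" .
qed simp

lemma convex_logistic_risk:
  assumes "sym_pos_def C"
  shows "convex_on UNIV (logistic_risk m C)"
  using convex_on_integral_inner[OF convex_logistic_loss integrable_logistic_loss[OF assms]]
  by (simp add: logistic_risk_def[abs_def])

lemma logistic_risk_midpoint_less:
  fixes v w :: "real^'n"
  assumes C: "sym_pos_def C" and "v \<noteq> w"
  shows "logistic_risk m C ((1 / 2) *\<^sub>R (v + w)) < (logistic_risk m C v + logistic_risk m C w) / 2"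
proof -
  let ?l = logistic_loss
  let ?f = "\<lambda>x. (?l (v \<bullet> x) + ?l (w \<bullet> x)) / 2 - ?l (((1 / 2) *\<^sub>R (v + w)) \<bullet> x)"
  have mid: "((1 / 2) *\<^sub>R (v + w)) \<bullet> x = (v \<bullet> x + w \<bullet> x) / 2" for x
    by (simp add: inner_add_left)
  note i = integrable_logistic_loss[OF C, of m]
  have avg: "integrable (mvn m C) (\<lambda>x. (?l (v \<bullet> x) + ?l (w \<bullet> x)) / 2)"
    "(\<integral>x. (?l (v \<bullet> x) + ?l (w \<bullet> x)) / 2 \<partial>mvn m C) = (logistic_risk m C v + logistic_risk m C w) / 2"
    using i[of v] i[of w] by (simp_all add: logistic_risk_def)
  have int: "integrable (mvn m C) ?f"
    by (rule Bochner_Integration.integrable_diff[OF avg(1) i])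
  have "0 < (\<integral>x. ?f x \<partial>mvn m C)"
  proof (rule mvn_integral_pos[OF C int])
    show "continuous_on UNIV ?f" by (intro continuous_intros) auto
    show "0 \<le> ?f x" for x
      using logistic_loss_midpoint_less[of "v \<bullet> x" "w \<bullet> x"] unfolding mid
      by (cases "v \<bullet> x = w \<bullet> x") auto
    \<comment> \<open>At the point \<open>v - w\<close> the two inner products differ by the squared
      norm of \<open>v - w\<close>, so the integrand is nonzero there.\<close>
    have "v \<bullet> (v - w) \<noteq> w \<bullet> (v - w)"
      using \<open>v \<noteq> w\<close> by (metis inner_diff_left inner_eq_zero_iff right_minus_eq)
    then show "?f (v - w) \<noteq> 0"
      using logistic_loss_midpoint_less[of "v \<bullet> (v - w)" "w \<bullet> (v - w)"] unfolding mid by simp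
  qed
  also have "(\<integral>x. ?f x \<partial>mvn m C) = (logistic_risk m C v + logistic_risk m C w) / 2 - logistic_risk m C ((1 / 2) *\<^sub>R (v + w))"
    by (simp only: Bochner_Integration.integral_diff[OF avg(1) i] avg(2) logistic_risk_def)
  finally show ?thesis by simp
qed

text \<open>The loss dominates \<open>max 0 (- t)\<close>, whose Gaussian average \<open>K\<close>
  is positively homogeneous in \<open>w\<close> and positive away from 0. The constant is the
  minimum of \<open>K\<close> on the unit sphere, attained since \<open>K\<close> is convex and so
  continuous.\<close>

lemma logistic_risk_coercive:
  fixes m :: "real^'n"
  assumes C: "sym_pos_def C"
  obtains \<delta> where "\<delta> > 0" "\<And>w. \<delta> * norm w \<le> logistic_risk m C w"
proof -
  define K where "K w = (\<integral>x. max 0 (- (w \<bullet> x)) \<partial>mvn m C)" for w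
  have int: "integrable (mvn m C) (\<lambda>x. max 0 (- (w \<bullet> x)))" for w
    using mvn_integrable_inner[OF C] by (intro integrable_max) auto
  have "convex_on UNIV (\<lambda>t::real. max 0 (- t))"
  proof (rule convex_onI)
    fix t x y :: real assume "0 < t" "t < 1"
    then have "(1 - t) * - x \<le> (1 - t) * max 0 (- x)" "t * - y \<le> t * max 0 (- y)"
      by (intro mult_left_mono; simp)+
    moreover have "0 \<le> (1 - t) * max 0 (- x)" "0 \<le> t * max 0 (- y)"
      using \<open>0 < t\<close> \<open>t < 1\<close> by simp_all
    ultimately show "max 0 (- ((1 - t) *\<^sub>R x + t *\<^sub>R y)) \<le> (1 - t) * max 0 (- x) + t * max 0 (- y)"
      by simp
  qed simp
  then have "convex_on UNIV K"
    unfolding K_def by (rule convex_on_integral_inner) (rule int)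
  then have cont: "continuous_on UNIV K" by (rule convex_on_continuous[OF open_UNIV])
  have pos: "K w > 0" if "w \<noteq> 0" for w
    unfolding K_def
  proof (rule mvn_integral_pos[OF C int, where ?x0.0 = "- w"])
    show "max 0 (- (w \<bullet> - w)) \<noteq> 0" using that by (simp add: max_def)
  qed (auto intro!: continuous_intros)
  have "sphere (0 :: real^'n) 1 \<noteq> {}" by simp
  then obtain w0 where w0: "w0 \<in> sphere 0 1" "\<And>w. w \<in> sphere 0 1 \<Longrightarrow> K w0 \<le> K w"
    using continuous_attains_inf[OF compact_sphere] cont continuous_on_subset by (metis subset_UNIV)
  show thesis
  proof
    show "K w0 > 0" using w0(1) by (intro pos) auto
    fix w :: "real^'n"
    show "K w0 * norm w \<le> logistic_risk m C w"
    proof (cases "w = 0")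
      case False
      have "K w = norm w * K (w /\<^sub>R norm w)"
      proof -
        have "max 0 (- (w \<bullet> x)) = norm w * max 0 (- ((w /\<^sub>R norm w) \<bullet> x))" for x
        proof -
          have "norm w * - ((w /\<^sub>R norm w) \<bullet> x) = - (w \<bullet> x)" using False by simp
          then show ?thesis
            by (simp only: max_mult_distrib_left norm_ge_zero if_True mult_zero_right)
        qed
        then show ?thesis unfolding K_def by simp
      qed
      also have "\<dots> \<ge> norm w * K w0"
        using False by (intro mult_left_mono w0(2)) auto
      finally have "K w0 * norm w \<le> K w" by (simp add: mult.commute)
      also have "K w \<le> logistic_risk m C w"
        unfolding K_def logistic_risk_def
        by (intro integral_mono int integrable_logistic_loss[OF C])
           (simp add: logistic_loss_nonneg logistic_loss_ge_neg)
      finally show ?thesis .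
    qed (simp add: logistic_risk_def logistic_loss_nonneg)
  qed
qed

lemma logistic_risk_zero:
  assumes "sym_pos_def C"
  shows "logistic_risk m C 0 = ln 2"
proof -
  interpret prob_space "mvn m C" by (rule prob_space_mvn[OF assms])
  show ?thesis by (simp add: logistic_risk_def logistic_loss_zero prob_space[unfolded space_mvn])
qed

lemma logistic_risk_has_minimizer:
  fixes m :: "real^'n"
  assumes C: "sym_pos_def C"
  obtains w where "\<And>v. logistic_risk m C w \<le> logistic_risk m C v"
proof -
  obtain \<delta> where \<delta>: "\<delta> > 0" "\<And>w. \<delta> * norm w \<le> logistic_risk m C w"
    using logistic_risk_coercive[OF C] by blast
  \<comment> \<open>Outside this ball the coercive bound exceeds \<open>ln 2\<close>, the risk at
    the origin, so a minimizer on the ball is a global one.\<close>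
  define R where "R = ln 2 / \<delta>"
  have R: "R \<ge> 0" using \<delta> by (simp add: R_def)
  have "continuous_on UNIV (logistic_risk m C)"
    by (rule convex_on_continuous[OF open_UNIV convex_logistic_risk[OF C]])
  then have "continuous_on (cball 0 R) (logistic_risk m C)" by (rule continuous_on_subset) simp
  moreover have "cball (0 :: real^'n) R \<noteq> {}" using R by simp
  ultimately obtain w where w: "\<And>v. v \<in> cball 0 R \<Longrightarrow> logistic_risk m C w \<le> logistic_risk m C v"
    using continuous_attains_inf[OF compact_cball] by blast
  show thesis
  proof
    fix v
    show "logistic_risk m C w \<le> logistic_risk m C v"
    proof (cases "v \<in> cball 0 R")
      case False
      have "logistic_risk m C w \<le> ln 2" using w[of 0] R by (simp add: logistic_risk_zero[OF C])
      also have "\<dots> = \<delta> * R" using \<delta> by (simp add: R_def)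
      also have "\<dots> \<le> \<delta> * norm v" using False \<delta> by simp
      also have "\<dots> \<le> logistic_risk m C v" by (rule \<delta>)
      finally show ?thesis .
    qed (rule w)
  qed
qed

lemma logistic_risk_minimizer_unique:
  assumes C: "sym_pos_def C"
    and "\<And>u. logistic_risk m C v \<le> logistic_risk m C u" "\<And>u. logistic_risk m C w \<le> logistic_risk m C u"
  shows "v = w"
proof (rule ccontr)
  assume "v \<noteq> w"
  from logistic_risk_midpoint_less[OF C this, of m] show False
    using assms(2)[of w] assms(3)[of v] assms(2)[of "(1 / 2) *\<^sub>R (v + w)"] by simp
qed

text \<open>Integrating the tangent bound at 0 gives this; its use is that a risk below
  \<open>ln 2\<close> forces \<open>w \<bullet> m > 0\<close>.\<close>

lemma logistic_risk_ge_tangent: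
  assumes C: "sym_pos_def C"
  shows "ln 2 - (w \<bullet> m) / 2 \<le> logistic_risk m C w"
proof -
  interpret prob_space "mvn m C" by (rule prob_space_mvn[OF C])
  note int = mvn_integrable_inner[OF C, of m w]
  have "ln 2 - (w \<bullet> m) / 2 = (\<integral>x. ln 2 - (w \<bullet> x) / 2 \<partial>mvn m C)"
    using int mvn_integral_inner[OF C, of m w] by (simp add: prob_space[unfolded space_mvn])
  also have "\<dots> \<le> logistic_risk m C w"
    unfolding logistic_risk_def using int
    by (intro integral_mono integrable_logistic_loss[OF C] logistic_loss_ge_tangent) auto
  finally show ?thesis .
qed

lemma logistic_risk_le_quadratic:
  assumes C: "sym_pos_def C"
  shows "logistic_risk m C w \<le> ln 2 - (w \<bullet> m) / 2 + (\<integral>x. (w \<bullet> x)\<^sup>2 \<partial>mvn m C) / 2"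
proof -
  interpret prob_space "mvn m C" by (rule prob_space_mvn[OF C])
  note int = mvn_integrable_inner[OF C, of m w] mvn_integrable_inner_square[OF C, of m w]
  have "logistic_risk m C w \<le> (\<integral>x. ln 2 - (w \<bullet> x) / 2 + (w \<bullet> x)\<^sup>2 / 2 \<partial>mvn m C)"
    unfolding logistic_risk_def using int
    by (intro integral_mono integrable_logistic_loss[OF C] logistic_loss_le_quadratic) auto
  also have "\<dots> = ln 2 - (w \<bullet> m) / 2 + (\<integral>x. (w \<bullet> x)\<^sup>2 \<partial>mvn m C) / 2"
    using int mvn_integral_inner[OF C, of m w] by (simp add: prob_space[unfolded space_mvn])
  finally show ?thesis .
qed

text \<open>Along \<open>\<epsilon> *\<^sub>R m\<close> the linear gain
  \<open>\<epsilon> * (m \<bullet> m) / 2\<close> beats the quadratic cost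
  \<open>\<epsilon>\<^sup>2 * q / 2\<close> once \<open>\<epsilon>\<close> is small.\<close>

lemma exists_logistic_risk_less_ln_2:
  fixes m :: "real^'n"
  assumes C: "sym_pos_def C" and "m \<noteq> 0"
  obtains w where "logistic_risk m C w < ln 2"
proof -
  define q where "q = (\<integral>x. (m \<bullet> x)\<^sup>2 \<partial>mvn m C)"
  have q: "q \<ge> 0" unfolding q_def by simp
  have mm: "m \<bullet> m > 0" using \<open>m \<noteq> 0\<close> by simp
  \<comment> \<open>This makes \<open>\<epsilon> * q\<close> less than \<open>m \<bullet> m\<close>;
    the summand 1 keeps the denominator positive.\<close>
  define \<epsilon> where "\<epsilon> = (m \<bullet> m) / (q + 1) / 2"
  have \<epsilon>: "\<epsilon> > 0" using q mm by (simp add: \<epsilon>_def)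
  have "\<epsilon> * q < m \<bullet> m"
  proof -
    have "\<epsilon> * q \<le> \<epsilon> * (q + 1)" using \<epsilon> by simp
    also have "\<dots> = (m \<bullet> m) / 2" using q by (simp add: \<epsilon>_def field_simps)
    finally show ?thesis using mm by linarith
  qed
  then have "\<epsilon> * (\<epsilon> * q) < \<epsilon> * (m \<bullet> m)" using \<epsilon> by (rule mult_strict_left_mono)
  moreover have "(\<integral>x. ((\<epsilon> *\<^sub>R m) \<bullet> x)\<^sup>2 \<partial>mvn m C) = \<epsilon> * (\<epsilon> * q)"
  proof -
    have "((\<epsilon> *\<^sub>R m) \<bullet> x)\<^sup>2 = \<epsilon> * (\<epsilon> * (m \<bullet> x)\<^sup>2)" for x
      by (simp add: power2_eq_square)
    then show ?thesis unfolding q_def by (simp only: integral_mult_right_zero)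
  qed
  ultimately have "logistic_risk m C (\<epsilon> *\<^sub>R m) < ln 2"
    using logistic_risk_le_quadratic[OF C, of m "\<epsilon> *\<^sub>R m"] by simp
  then show thesis by (rule that)
qed

lemma logistic_risk_minimizer_direction:
  fixes m w :: "real^'n"
  assumes C: "sym_pos_def C" and "m \<noteq> 0" and min: "\<And>u. logistic_risk m C w \<le> logistic_risk m C u"
  obtains c where "c > 0" "w = c *\<^sub>R (matrix_inv C *v m)"
proof -
  define v where "v = matrix_inv C *v m"
  have Cv: "C *v v = m" by (simp add: v_def matrix_inv_vector[OF C])
  then have "v \<noteq> 0" using \<open>m \<noteq> 0\<close> by auto
  then have vm: "v \<bullet> m > 0" using C Cv by (metis sym_pos_def_def)
  have sym: "x \<bullet> (C *v y) = y \<bullet> (C *v x)" for x y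
    using C by (metis dot_lmul_matrix inner_commute sym_pos_def_def transpose_matrix_vector)
  \<comment> \<open>Since \<open>C *v v = m\<close>, this is twice the coefficient of the
    \<open>C\<close>-orthogonal projection of \<open>w\<close> to the line through
    \<open>v\<close>.\<close>
  define a where "a = 2 * (w \<bullet> m) / (v \<bullet> m)"
  \<comment> \<open>the reflection of \<open>w\<close> in the line through \<open>v\<close>, orthogonal for the inner product given by \<open>C\<close>\<close>
  define w' where "w' = a *\<^sub>R v - w"
  have a: "a * (v \<bullet> m) = 2 * (w \<bullet> m)" using vm by (simp add: a_def)
  have mean: "w' \<bullet> m = w \<bullet> m" by (simp add: w'_def inner_diff_left a)
  have "C *v w' = a *\<^sub>R m - C *v w"
    by (simp add: w'_def matrix_vector_mult_diff_distrib matrix_vector_mult_scaleR Cv)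
  then have "w' \<bullet> (C *v w') = a * (w' \<bullet> m) - a * (v \<bullet> (C *v w)) + w \<bullet> (C *v w)"
    by (simp add: inner_diff_right) (simp add: w'_def inner_diff_left)
  also have "v \<bullet> (C *v w) = w \<bullet> m" using sym[of v w] Cv by simp
  finally have var: "w' \<bullet> (C *v w') = w \<bullet> (C *v w)" by (simp add: mean)
  have risk: "logistic_risk m C u = (\<integral>t. logistic_loss t \<partial>distr (mvn m C) borel (\<lambda>x. u \<bullet> x))" for u
    unfolding logistic_risk_def by (subst integral_distr) auto
  have "logistic_risk m C w' = logistic_risk m C w"
    unfolding risk distr_mvn_inner_cong[OF C C mean var] ..
  then have "w' = w" using min by (intro logistic_risk_minimizer_unique[OF C, of m]) auto
  then have "2 *\<^sub>R w = a *\<^sub>R v" by (simp add: w'_def scaleR_2 algebra_simps)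
  then have "w = (a / 2) *\<^sub>R v"
    by (metis (no_types) divide_inverse mult.commute scaleR_half_double scaleR_scaleR scaleR_2 inverse_eq_divide mult_1)
  moreover have "a / 2 > 0"
  proof -
    \<comment> \<open>The minimal risk lies below \<open>ln 2\<close>, so the tangent bound makes
      \<open>w \<bullet> m\<close>, and with it \<open>a\<close>, positive.\<close>
    obtain u where "logistic_risk m C u < ln 2" using exists_logistic_risk_less_ln_2[OF C \<open>m \<noteq> 0\<close>] .
    then have "w \<bullet> m > 0"
      using min[of u] logistic_risk_ge_tangent[OF C, of w m] by simp
    then show ?thesis using vm by (simp add: a_def)
  qed
  ultimately show thesis using that v_def by blast
qed

theorem theorem3p1:
  fixes \<mu> :: "real ^ 'd" and \<Sigma> :: "real ^ 'd ^ 'd" and \<kappa> :: real and n :: nat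
  assumes "\<mu> \<noteq> 0"
    and "sym_pos_def \<Sigma>"
    and "(norm \<mu>)\<^sup>2 = spectral_norm \<Sigma>"
    and "\<kappa> > 0"
    and "n \<ge> 1"
  shows "(\<exists>!w. is_arg_min (expected_erm_loss \<mu> \<Sigma> \<kappa> n) (\<lambda>_. True) w) \<and>
         (\<forall>w. is_arg_min (expected_erm_loss \<mu> \<Sigma> \<kappa> n) (\<lambda>_. True) w \<longrightarrow>
              (\<exists>c>0. w = c *\<^sub>R (matrix_inv \<Sigma> *v \<mu>)))"
proof -
  define C where "C = (1 / \<kappa>) *\<^sub>R \<Sigma>"
  have Cv: "C *v x = (1 / \<kappa>) *\<^sub>R (\<Sigma> *v x)" for x
    by (simp add: C_def scaleR_matrix_vector_assoc)
  have "transpose C = C"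
    using assms(2) by (simp add: C_def sym_pos_def_def transpose_scalar)
  then have C: "sym_pos_def C"
    using assms(2,4) by (simp add: sym_pos_def_def Cv)
  have risk: "expected_erm_loss \<mu> \<Sigma> \<kappa> n = logistic_risk \<mu> C"
    using expected_erm_loss_eq_logistic_risk[OF C[unfolded C_def] \<open>n \<ge> 1\<close>] by (auto simp: C_def)
  have "C *v (\<kappa> *\<^sub>R (matrix_inv \<Sigma> *v \<mu>)) = \<mu>"
    using \<open>\<kappa> > 0\<close> by (simp add: Cv matrix_vector_mult_scaleR matrix_inv_vector[OF assms(2)])
  then have inv: "matrix_inv C *v \<mu> = \<kappa> *\<^sub>R (matrix_inv \<Sigma> *v \<mu>)"
    using matrix_inv_vector(2)[OF C] by metis
  have min: "is_arg_min (logistic_risk \<mu> C) (\<lambda>_. True) w \<longleftrightarrow> (\<forall>u. logistic_risk \<mu> C w \<le> logistic_risk \<mu> C u)" for w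
    by (auto simp: is_arg_min_linorder)
  show ?thesis
    unfolding risk min
  proof (intro conjI allI impI)
    obtain w where w: "\<And>u. logistic_risk \<mu> C w \<le> logistic_risk \<mu> C u"
      using logistic_risk_has_minimizer[OF C] by blast
    show "\<exists>!w. \<forall>u. logistic_risk \<mu> C w \<le> logistic_risk \<mu> C u"
      using w logistic_risk_minimizer_unique[OF C] by (intro ex1I[of _ w]) blast+
  next
    fix w assume "\<forall>u. logistic_risk \<mu> C w \<le> logistic_risk \<mu> C u"
    then obtain c where c: "c > 0" "w = c *\<^sub>R (matrix_inv C *v \<mu>)"
      using logistic_risk_minimizer_direction[OF C \<open>\<mu> \<noteq> 0\<close>] by blast
    then show "\<exists>c>0. w = c *\<^sub>R (matrix_inv \<Sigma> *v \<mu>)"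
      \<comment> \<open>Scaling the covariance by \<open>1 / \<kappa>\<close> multiplies its inverse
        by \<open>\<kappa>\<close>, which is absorbed into the positive constant.\<close>
      using \<open>\<kappa> > 0\<close> by (intro exI[of _ "c * \<kappa>"]) (simp add: inv)
  qed
qed

end
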